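(* There exists a string family on which $\ell = o(\ell_e)$.
   Context: A string family is an infinite set of finite strings of unbounded length; asymptotic notation on a family refers to strings $w$ of the family with $n=|w|\to\infty$ (with constants uniform over the family). $w[i:j]$ denotes the substring of $w$ from position $i$ to position $j$ (positions start at 1). L-systems: an L-system is a tuple $(\Sigma,\varphi,\tau,s,d,n)$, where $\Sigma$ is a finite alphabet, $\varphi:\Sigma^*\to\Sigma^*$ is a non-erasing monoid endomorphism (each rule $a\to\varphi(a)$, $a\in\Sigma$, has $|\varphi(a)|\ge 1$), $\tau:\Sigma^*\to\Sigma^*$ is a coding (a morphism with $|\tau(a)|=1$ for all $a\in\Sigma$), $s\in\Sigma^+$ is the axiom, and $d\ge 0$, $n\ge 1$ are integers. It generates the unique string $\tau(\varphi^d(s))[1:n]$ of length $n$. It is always assumed that $d=n^{O(1)}$ and $|\Sigma|=n^{O(1)}$ (each value fits in an $O(\log n)$-bit word). The size of the L-system is $\sum_{a\in\Sigma}|\varphi(a)|+|s|+|\Sigma|+2$. The measure $\ell(w)$ is the size of the smallest L-system generating $w$. $\ell_e(w)$ is the size of the smallest L-system generating $w$ all of whose rules have size at least 2, i.e. $|\varphi(a)|\ge 2$ for all $a\in\Sigma$. *)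

theory Defs
  imports "HOL-Library.Landau_Symbols"
begin

text \<open>
  Symbols are natural numbers. Alphabets are arbitrary finite sets of symbols, so up to renaming
  every finite alphabet, of any cardinality, is covered. A monoid endomorphism of
  \<open>\<Sigma>\<^sup>*\<close> is given by the images of the letters; its values outside
  \<open>\<Sigma>\<close> are irrelevant.
\<close>

type_synonym symbol = nat
type_synonym word = "symbol list"

definition morphism_of :: "(symbol \<Rightarrow> word) \<Rightarrow> word \<Rightarrow> word" where
  "morphism_of f w = concat (map f w)"

record lsystem =
  sigma :: "symbol set"
  phi :: "symbol \<Rightarrow> word"
  tau :: "symbol \<Rightarrow> word"
  axiom_word :: word
  depth :: nat
  len :: nat

definition is_lsystem :: "lsystem \<Rightarrow> bool" where
  "is_lsystem L \<longleftrightarrow>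
     finite (sigma L) \<and>
     (\<forall>a\<in>sigma L. set (phi L a) \<subseteq> sigma L \<and> length (phi L a) \<ge> 1) \<and>
     (\<forall>a\<in>sigma L. set (tau L a) \<subseteq> sigma L \<and> length (tau L a) = 1) \<and>
     set (axiom_word L) \<subseteq> sigma L \<and> axiom_word L \<noteq> [] \<and>
     len L \<ge> 1"

definition derived_word :: "lsystem \<Rightarrow> word" where
  "derived_word L =
     morphism_of (tau L) ((morphism_of (phi L) ^^ depth L) (axiom_word L))"

text \<open>
  The length condition makes the prefix of length \<open>n\<close> well-defined:
  \<open>take\<close> would otherwise silently return a shorter word.
\<close>

definition generates :: "lsystem \<Rightarrow> word \<Rightarrow> bool" where
  "generates L w \<longleftrightarrow>
     len L \<le> length (derived_word L) \<and> w = take (len L) (derived_word L)"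

definition lsystem_size :: "lsystem \<Rightarrow> nat" where
  "lsystem_size L =
     (\<Sum>a\<in>sigma L. length (phi L a)) + length (axiom_word L) + card (sigma L) + 2"

text \<open>
  The standing assumptions \<open>d = n\<^bsup>O(1)\<^esup>\<close> and
  \<open>\<bar>\<Sigma>\<bar> = n\<^bsup>O(1)\<^esup>\<close>, with the exponent \<open>c\<close> made explicit.
\<close>

definition poly_bounded :: "nat \<Rightarrow> lsystem \<Rightarrow> bool" where
  "poly_bounded c L \<longleftrightarrow> depth L \<le> len L ^ c \<and> card (sigma L) \<le> len L ^ c"

definition expanding :: "lsystem \<Rightarrow> bool" where
  "expanding L \<longleftrightarrow> (\<forall>a\<in>sigma L. length (phi L a) \<ge> 2)"

definition ell :: "nat \<Rightarrow> word \<Rightarrow> nat" where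
  "ell c w = (LEAST m. \<exists>L. is_lsystem L \<and> poly_bounded c L \<and> generates L w
                        \<and> lsystem_size L = m)"

definition ell_e :: "nat \<Rightarrow> word \<Rightarrow> nat" where
  "ell_e c w = (LEAST m. \<exists>L. is_lsystem L \<and> poly_bounded c L \<and> expanding L \<and> generates L w
                          \<and> lsystem_size L = m)"

text \<open>
  For \<open>c \<ge> 1\<close> both minima range over nonempty sets, for every nonempty word:
\<close>

lemma ex_expanding_lsystem:
  assumes "w \<noteq> []" "c \<ge> 1"
  shows "\<exists>L. is_lsystem L \<and> poly_bounded c L \<and> expanding L \<and> generates L w"
proof -
  define L where "L = \<lparr>sigma = set w, phi = (\<lambda>a. [a, a]), tau = (\<lambda>a. [a]),
    axiom_word = w, depth = 0, len = length w\<rparr>"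
  have "length w \<le> length w ^ c"
    using assms by (simp add: self_le_power Suc_le_eq)
  then have "card (set w) \<le> length w ^ c"
    using card_length[of w] by linarith
  moreover have "1 \<le> length w"
    using assms(1) by (simp add: Suc_le_eq)
  moreover have "concat (map (\<lambda>a. [a]) w) = w"
    by simp
  ultimately have "is_lsystem L \<and> poly_bounded c L \<and> expanding L \<and> generates L w"
    using assms(1)
    by (simp add: L_def is_lsystem_def poly_bounded_def expanding_def generates_def
        derived_word_def morphism_of_def)
  then show ?thesis by blast
qed

definition string_family :: "word set \<Rightarrow> bool" where
  "string_family F \<longleftrightarrow> infinite F \<and> (\<forall>N. \<exists>w\<in>F. length w \<ge> N)"

text \<open>
  The filter ``\<open>w\<close> ranges over \<open>F\<close> and \<open>\<bar>w\<bar> \<rightarrow> \<infinity>\<close>'':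
\<close>

definition family_filter :: "word set \<Rightarrow> word filter" where
  "family_filter F = inf (filtercomap length at_top) (principal F)"

lemma eventually_family_filter:
  "eventually P (family_filter F) \<longleftrightarrow> (\<exists>N. \<forall>w\<in>F. length w \<ge> N \<longrightarrow> P w)"
  unfolding family_filter_def eventually_inf_principal eventually_filtercomap_at_top_linorder
  by blast

end

theory Submission
  imports Defs "HOL-Library.FuncSet" "HOL-Real_Asymp.Real_Asymp"
begin

text \<open>
  The words \<open>0\<^sup>d 1 0\<^sup>d\<close> are generated by one fixed non-expanding system, with
  the depth as the only parameter, so for each \<open>n = 2m + 1\<close> there are \<open>m + 1\<close>
  words of length \<open>n\<close>, the prefixes for \<open>m \<le> d \<le> 2m\<close>, with \<open>\<ell> = O(1)\<close>.
  In an expanding system the depth carries little information: if \<open>2\<^sup>D \<ge> n\<close>, then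
  for each depth \<open>d \<ge> D\<close> the prefix of length \<open>n\<close> is already determined by the first
  letter of \<open>\<phi>\<^bsup>d-D\<^esup>(s)\<close>. Hence a fixed expanding system of size at most \<open>K\<close>
  has at most \<open>D + K\<close> prefixes of length \<open>n\<close>, and up to renaming letters there are only
  finitely many such systems. So some word among the \<open>m + 1\<close> has \<open>\<ell>\<^sub>e > K\<close> once
  \<open>n\<close> is large, and the family collects for each \<open>m = 2\<^sup>k\<close> a word with the largest
  \<open>\<ell>\<^sub>e\<close>.
\<close>

section \<open>Iterates of a morphism\<close>

lemma funpow_morphism_of_append:
  "(morphism_of f ^^ d) (u @ v) = (morphism_of f ^^ d) u @ (morphism_of f ^^ d) v"
  by (induction d) (simp_all add: morphism_of_def)

lemma set_funpow_morphism_of: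
  assumes "\<And>x. x \<in> S \<Longrightarrow> set (f x) \<subseteq> S" "set u \<subseteq> S"
  shows "set ((morphism_of f ^^ d) u) \<subseteq> S"
  using assms by (induction d) (fastforce simp: morphism_of_def)+

lemma length_morphism_of_ge:
  assumes "\<And>x. x \<in> S \<Longrightarrow> q \<le> length (f x)" "set u \<subseteq> S"
  shows "q * length u \<le> length (morphism_of f u)"
  using assms(2) by (induction u) (auto simp: morphism_of_def intro!: add_mono assms(1))

lemma length_funpow_morphism_of_ge:
  assumes "\<And>x. x \<in> S \<Longrightarrow> set (f x) \<subseteq> S" "\<And>x. x \<in> S \<Longrightarrow> q \<le> length (f x)" "set u \<subseteq> S"
  shows "q ^ d * length u \<le> length ((morphism_of f ^^ d) u)"
proof (induction d)
  case (Suc d)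
  have "q ^ Suc d * length u \<le> q * length ((morphism_of f ^^ d) u)"
    using Suc.IH by simp
  also have "\<dots> \<le> length (morphism_of f ((morphism_of f ^^ d) u))"
    using assms by (intro length_morphism_of_ge[of S] set_funpow_morphism_of) auto
  finally show ?case by simp
qed simp

text \<open>The iterates stay inside \<open>S\<close>, where \<open>h\<close> intertwines
  \<open>f\<close> and \<open>f'\<close>. This serves to replace the letters of a system by numbers
  below \<open>K\<close>.\<close>

lemma map_funpow_morphism_of:
  assumes "\<And>x. x \<in> S \<Longrightarrow> set (f x) \<subseteq> S" "set u \<subseteq> S"
    and "\<And>x. x \<in> S \<Longrightarrow> f' (h x) = map h (f x)"
  shows "map h ((morphism_of f ^^ d) u) = (morphism_of f' ^^ d) (map h u)"
proof (induction d)
  case (Suc d)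
  have "map h (morphism_of f v) = morphism_of f' (map h v)" if "set v \<subseteq> S" for v
    using that by (induction v) (auto simp: morphism_of_def assms(3))
  then show ?case
    using Suc.IH set_funpow_morphism_of[of S f u d] assms by simp
qed simp

section \<open>Counting the words of expanding systems\<close>

definition code_words :: "nat \<Rightarrow> (nat \<Rightarrow> nat list) \<times> (nat \<Rightarrow> 'a) \<times> nat list \<Rightarrow> 'a list set" where
  "code_words n = (\<lambda>(f, t, s). range (\<lambda>d. take n (map t ((morphism_of f ^^ d) s))))"

text \<open>
  The codes contain, up to renaming letters to numbers below \<open>K\<close>, the expanding systems of
  size at most \<open>K\<close>; the coding \<open>\<tau>\<close> only records which letters are mapped to
  \<open>1\<close>.
\<close>

definition expanding_codes :: "nat \<Rightarrow> ((nat \<Rightarrow> nat list) \<times> (nat \<Rightarrow> bool) \<times> nat list) set" where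
  "expanding_codes K =
     ({..<K} \<rightarrow>\<^sub>E {u. set u \<subseteq> {..<K} \<and> 2 \<le> length u \<and> length u \<le> K}) \<times>
     ({..<K} \<rightarrow>\<^sub>E UNIV) \<times>
     {u. set u \<subseteq> {..<K} \<and> u \<noteq> [] \<and> length u \<le> K}"

lemma finite_expanding_codes: "finite (expanding_codes K)"
proof -
  have fin: "finite {u. set u \<subseteq> {..<K} \<and> length u \<le> K}"
    by (rule finite_lists_length_le) simp
  have "finite {u. set u \<subseteq> {..<K} \<and> 2 \<le> length u \<and> length u \<le> K}"
    by (rule finite_subset[OF _ fin]) auto
  moreover have "finite {u. set u \<subseteq> {..<K} \<and> u \<noteq> [] \<and> length u \<le> K}"
    by (rule finite_subset[OF _ fin]) auto
  ultimately show ?thesis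
    unfolding expanding_codes_def by (intro finite_cartesian_product finite_PiE) auto
qed

text \<open>The depths below \<open>D\<close> contribute the summand \<open>D\<close>; all larger
  depths together contribute at most one word per letter, hence the summand
  \<open>K\<close>.\<close>

lemma code_words_bound:
  assumes "X \<in> expanding_codes K" "n \<le> 2 ^ D"
  shows "finite (code_words n X)" "card (code_words n X) \<le> D + K"
proof -
  obtain f t s where X: "X = (f, t, s)" by (cases X)
  have f: "set (f x) \<subseteq> {..<K}" "2 \<le> length (f x)" if "x \<in> {..<K}" for x
    using assms(1) that unfolding X expanding_codes_def by (auto dest: PiE_mem)
  have s: "set s \<subseteq> {..<K}" "s \<noteq> []"
    using assms(1) by (auto simp: X expanding_codes_def)
  define p where "p d u = take n (map t ((morphism_of f ^^ d) u))" for d u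
  have sub: "code_words n X \<subseteq> (\<lambda>d. p d s) ` {..<D} \<union> (\<lambda>y. p D [y]) ` {..<K}"
  proof -
    have "p d s \<in> (\<lambda>y. p D [y]) ` {..<K}" if "\<not> d < D" for d
    proof -
      define e where "e = d - D"
      have "2 ^ e * length s \<le> length ((morphism_of f ^^ e) s)"
        by (rule length_funpow_morphism_of_ge[of "{..<K}"]) (use f s in auto)
      with s(2) have "(morphism_of f ^^ e) s \<noteq> []"
        by auto
      then obtain y r where yr: "(morphism_of f ^^ e) s = [y] @ r"
        by (metis append_Cons append_Nil list.exhaust)
      have "set ((morphism_of f ^^ e) s) \<subseteq> {..<K}"
        by (rule set_funpow_morphism_of) (use f s in auto)
      with yr have y: "y \<in> {..<K}" by simp
      \<comment> \<open>The letter \<open>y\<close> alone grows to at least \<open>n\<close> letters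
        in \<open>D\<close> steps, so the rest \<open>r\<close> lies beyond the prefix.\<close>
      have "2 ^ D * length [y] \<le> length ((morphism_of f ^^ D) [y])"
        by (rule length_funpow_morphism_of_ge[of "{..<K}"]) (use f y in auto)
      with assms(2) have "n \<le> length ((morphism_of f ^^ D) [y])" by simp
      moreover have "(morphism_of f ^^ d) s = (morphism_of f ^^ D) [y] @ (morphism_of f ^^ D) r"
      proof -
        have "(morphism_of f ^^ d) s = (morphism_of f ^^ D) ((morphism_of f ^^ e) s)"
          using that by (simp add: e_def flip: funpow_add comp_apply[of "morphism_of f ^^ D"])
        then show ?thesis by (simp only: yr funpow_morphism_of_append)
      qed
      ultimately have "p d s = p D [y]" by (simp add: p_def)
      with y show ?thesis by blast
    qed
    then show ?thesis by (auto simp: code_words_def X simp flip: p_def)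
  qed
  then show "finite (code_words n X)" by (rule finite_subset) simp
  have "card (code_words n X) \<le> card ((\<lambda>d. p d s) ` {..<D} \<union> (\<lambda>y. p D [y]) ` {..<K})"
    by (rule card_mono[OF _ sub]) simp
  also have "\<dots> \<le> card ((\<lambda>d. p d s) ` {..<D}) + card ((\<lambda>y. p D [y]) ` {..<K})"
    by (rule card_Un_le)
  also have "\<dots> \<le> D + K"
    by (intro add_mono order.trans[OF card_image_le]) auto
  finally show "card (code_words n X) \<le> D + K" .
qed

text \<open>The size bounds the alphabet, every rule and the axiom by \<open>K\<close>, so renaming
  the letters to numbers below \<open>K\<close> yields a code.\<close>

lemma generates_in_code_words:
  assumes "is_lsystem L" "expanding L" "generates L w" "lsystem_size L \<le> K"
  shows "\<exists>X\<in>expanding_codes K. map (\<lambda>x. x = 1) w \<in> code_words (length w) X"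
proof -
  define S where "S = sigma L"
  have fin: "finite S" and phi: "\<And>a. a \<in> S \<Longrightarrow> set (phi L a) \<subseteq> S"
    and phi2: "\<And>a. a \<in> S \<Longrightarrow> 2 \<le> length (phi L a)"
    and tau: "\<And>a. a \<in> S \<Longrightarrow> length (tau L a) = 1"
    and ax: "set (axiom_word L) \<subseteq> S" "axiom_word L \<noteq> []"
    using assms(1,2) by (auto simp: is_lsystem_def expanding_def S_def)
  have phiK: "length (phi L a) \<le> K" if "a \<in> S" for a
    using member_le_sum[of a S "\<lambda>a. length (phi L a)"] that fin assms(4)
    by (simp add: lsystem_size_def S_def)
  have axK: "length (axiom_word L) \<le> K" and cardK: "card S \<le> K"
    using assms(4) by (auto simp: lsystem_size_def S_def)
  have "S \<noteq> {}" using ax by auto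
  moreover have "\<exists>h. inj_on h S \<and> h ` S \<subseteq> {..<K}"
    using card_le_inj[OF fin, of "{..<K}"] cardK by auto
  ultimately obtain g where g: "g ` {..<K} = S"
    using inj_on_iff_surj by metis
  define h where "h = inv_into {..<K} g"
  have gh: "g (h x) = x" and hK: "h x < K" if "x \<in> S" for x
    using that g inv_into_into[of x g "{..<K}"] by (auto simp: h_def f_inv_into_f)
  define f where "f = restrict (\<lambda>i. map h (phi L (g i))) {..<K}"
  define t where "t = restrict (\<lambda>i. hd (tau L (g i)) = 1) {..<K}"
  define s where "s = map h (axiom_word L)"
  have gS: "g i \<in> S" if "i < K" for i using g that by auto
  have X: "(f, t, s) \<in> expanding_codes K"
  proof -
    have "set (f i) \<subseteq> {..<K} \<and> 2 \<le> length (f i) \<and> length (f i) \<le> K" if "i < K" for i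
      using phi[OF gS[OF that]] phi2[OF gS[OF that]] phiK[OF gS[OF that]] hK that
      by (auto simp: f_def)
    then have "f \<in> {..<K} \<rightarrow>\<^sub>E {u. set u \<subseteq> {..<K} \<and> 2 \<le> length u \<and> length u \<le> K}"
      by (intro PiE_I) (auto simp: f_def)
    moreover have "t \<in> {..<K} \<rightarrow>\<^sub>E UNIV"
      by (simp add: t_def)
    moreover have "set s \<subseteq> {..<K} \<and> s \<noteq> [] \<and> length s \<le> K"
      using ax axK hK by (auto simp: s_def)
    ultimately show ?thesis
      by (simp add: expanding_codes_def)
  qed
  define v where "v = (morphism_of (phi L) ^^ depth L) (axiom_word L)"
  have v: "set v \<subseteq> S"
    unfolding v_def by (rule set_funpow_morphism_of) (use phi ax in auto)
  have "map h v = (morphism_of f ^^ depth L) s"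
    unfolding v_def s_def
    by (rule map_funpow_morphism_of[of S]) (use phi ax gh hK in \<open>auto simp: f_def\<close>)
  moreover have "map (\<lambda>x. x = 1) (morphism_of (tau L) u) = map t (map h u)" if "set u \<subseteq> S" for u
    using that
  proof (induction u)
    case (Cons a u)
    then obtain b where "tau L a = [b]"
      using tau[of a] by (auto simp: length_Suc_conv)
    with Cons show ?case by (simp add: morphism_of_def t_def gh hK)
  qed (simp add: morphism_of_def)
  ultimately have "map (\<lambda>x. x = 1) (derived_word L) = map t ((morphism_of f ^^ depth L) s)"
    using v by (metis derived_word_def v_def)
  moreover have "w = take (length w) (derived_word L)"
    using assms(3) by (auto simp: generates_def)
  ultimately have "map (\<lambda>x. x = 1) w = take (length w) (map t ((morphism_of f ^^ depth L) s))"
    by (metis take_map)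
  with X show ?thesis by (auto simp: code_words_def intro!: bexI[of _ "(f, t, s)"])
qed

section \<open>Expanding systems of arbitrary depth\<close>

text \<open>
  The measure \<open>\<ell>\<^sub>e\<close> without the bound on the depth. It lets one family serve all
  exponents \<open>c\<close>.
\<close>

definition ell_e_unbounded :: "word \<Rightarrow> nat" where
  "ell_e_unbounded w =
     (LEAST m. \<exists>L. is_lsystem L \<and> expanding L \<and> generates L w \<and> lsystem_size L = m)"

text \<open>The right-hand minimum is over fewer systems; the hypotheses make their set nonempty, so
  that this \<open>LEAST\<close> is attained.\<close>

lemma ell_e_unbounded_le:
  assumes "w \<noteq> []" "c \<ge> 1"
  shows "ell_e_unbounded w \<le> ell_e c w"
proof -
  have "\<exists>m L. is_lsystem L \<and> poly_bounded c L \<and> expanding L \<and> generates L w \<and> lsystem_size L = m"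
    using ex_expanding_lsystem[OF assms] by blast
  from LeastI_ex[OF this] show ?thesis
    unfolding ell_e_unbounded_def ell_e_def[symmetric] by (intro Least_le) blast
qed

lemma ell_e_unbounded_attained:
  assumes "w \<noteq> []"
  obtains L where "is_lsystem L" "expanding L" "generates L w" "lsystem_size L = ell_e_unbounded w"
proof -
  have "\<exists>m L. is_lsystem L \<and> expanding L \<and> generates L w \<and> lsystem_size L = m"
    using ex_expanding_lsystem[OF assms, of 1] by blast
  from LeastI_ex[OF this] show ?thesis
    unfolding ell_e_unbounded_def[symmetric] using that by blast
qed

section \<open>Words with a single 1, and the pigeonhole argument\<close>

definition marked_word :: "nat \<Rightarrow> nat \<Rightarrow> word" where
  "marked_word m d = replicate d 0 @ 1 # replicate (2 * m - d) 0"

lemma length_marked_word: "d \<le> 2 * m \<Longrightarrow> length (marked_word m d) = 2 * m + 1"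
  by (simp add: marked_word_def)

lemma marked_word_nonempty: "marked_word m d \<noteq> []"
  by (simp add: marked_word_def)

text \<open>The number of letters before the \<open>1\<close> recovers \<open>d\<close>, even from
  the indicator of \<open>1\<close>, which is all that the codes produce.\<close>

lemma inj_marked_word: "inj (\<lambda>d. map (\<lambda>x. x = 1) (marked_word m d))"
proof (rule inj_on_inverseI)
  show "length (takeWhile Not (map (\<lambda>x. x = 1) (marked_word m d))) = d" for d
    by (simp add: marked_word_def takeWhile_append)
qed

text \<open>The rules 1 -> 010 and 0 -> 0 turn the axiom 1 into 0^d 1 0^d. The size is 4 for the
  rules, 1 for the axiom, 2 for the letters, plus 2.\<close>

lemma ell_marked_word_le:
  assumes "m \<le> d" "d \<le> 2 * m" "m \<ge> 1" "c \<ge> 1"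
  shows "ell c (marked_word m d) \<le> 9"
proof -
  define f where "f = (\<lambda>x::symbol. if x = 1 then [0, 1, 0] else [0::symbol])"
  define L where "L = \<lparr>sigma = {0, 1}, phi = f, tau = (\<lambda>a. [a]), axiom_word = [1],
    depth = d, len = 2 * m + 1\<rparr>"
  have rep: "morphism_of f (replicate e 0) = replicate e 0" for e
    by (induction e) (simp_all add: morphism_of_def f_def)
  have "morphism_of f (replicate e 0 @ 1 # replicate e 0) =
      morphism_of f (replicate e 0) @ [0, 1, 0] @ morphism_of f (replicate e 0)" for e
    by (simp add: morphism_of_def f_def)
  then have "(morphism_of f ^^ e) [1] = replicate e 0 @ 1 # replicate e 0" for e
    by (induction e) (simp_all add: rep replicate_app_Cons_same)
  moreover have "morphism_of (\<lambda>a. [a]) u = u" for u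
    by (simp add: morphism_of_def)
  ultimately have der: "derived_word L = replicate d 0 @ 1 # replicate d 0"
    by (simp add: derived_word_def L_def)
  \<comment> \<open>The \<open>Suc\<close> form lets \<open>take\<close> pass the \<open>1\<close>;
    as \<open>m \<le> d\<close>, the \<open>2 * m - d\<close> zeros still wanted fit into the second
    block.\<close>
  have "2 * m + 1 - d = Suc (2 * m - d)" using assms by simp
  with der assms have gen: "generates L (marked_word m d)"
    by (simp add: generates_def L_def marked_word_def)
  have "2 * m + 1 \<le> (2 * m + 1) ^ c"
    using assms by (intro self_le_power) auto
  with assms have pb: "poly_bounded c L"
    by (simp add: poly_bounded_def L_def)
  have "is_lsystem L" and size: "lsystem_size L = 9"
    by (auto simp: is_lsystem_def L_def f_def lsystem_size_def)
  with gen pb show ?thesis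
    unfolding ell_def by (intro Least_le) blast
qed

text \<open>Pigeonhole: otherwise \<open>m + 1\<close> distinct indicator words would lie in a set
  of at most \<open>m\<close> words.\<close>

lemma ex_marked_word_ell_e_large:
  assumes "card (expanding_codes K) * (D + K) \<le> m" "2 * m + 1 \<le> 2 ^ D"
  shows "\<exists>d\<in>{m..2 * m}. K < ell_e_unbounded (marked_word m d)"
proof (rule ccontr)
  assume "\<not> ?thesis"
  then have small: "ell_e_unbounded (marked_word m d) \<le> K" if "d \<in> {m..2 * m}" for d
    using that by (meson not_less)
  define A where "A = (\<Union>X\<in>expanding_codes K. code_words (2 * m + 1) X)"
  have "(\<lambda>d. map (\<lambda>x. x = 1) (marked_word m d)) ` {m..2 * m} \<subseteq> A"
  proof (intro image_subsetI)
    fix d assume d: "d \<in> {m..2 * m}"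
    obtain L where "is_lsystem L" "expanding L" "generates L (marked_word m d)"
      "lsystem_size L = ell_e_unbounded (marked_word m d)"
      using ell_e_unbounded_attained[OF marked_word_nonempty] by metis
    with generates_in_code_words[of L "marked_word m d" K] small[OF d] d
    show "map (\<lambda>x. x = 1) (marked_word m d) \<in> A"
      by (simp add: A_def length_marked_word)
  qed
  moreover have "finite A"
    unfolding A_def using finite_expanding_codes code_words_bound(1)[OF _ assms(2)] by blast
  ultimately have "card {m..2 * m} \<le> card A"
    by (rule card_inj_on_le[OF inj_on_subset[OF inj_marked_word subset_UNIV]])
  also have "\<dots> \<le> (\<Sum>X\<in>expanding_codes K. card (code_words (2 * m + 1) X))"
    unfolding A_def by (rule card_UN_le[OF finite_expanding_codes])
  also have "\<dots> \<le> card (expanding_codes K) * (D + K)"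
    using sum_bounded_above[of "expanding_codes K" _ "D + K"] code_words_bound(2)[OF _ assms(2)]
    by simp
  finally show False using assms(1) by simp
qed

theorem lemma8:
  shows "\<exists>F. string_family F \<and>
           (\<forall>c\<ge>1. (\<lambda>w. real (ell c w)) \<in> o[family_filter F](\<lambda>w. real (ell_e c w)))"
proof -
  \<comment> \<open>Maximising makes the choice of \<open>d\<close> independent of \<open>K\<close>,
    so one family exceeds every bound \<open>K\<close>.\<close>
  have "\<exists>d. d \<in> {m..2 * m} \<and>
      (\<forall>e\<in>{m..2 * m}. ell_e_unbounded (marked_word m e) \<le> ell_e_unbounded (marked_word m d))" for m
  proof -
    define E where "E = (\<lambda>e. ell_e_unbounded (marked_word m e)) ` {m..2 * m}"
    have E: "finite E" "E \<noteq> {}" by (auto simp: E_def)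
    from Max_in[OF this] obtain d where d: "d \<in> {m..2 * m}"
      "Max E = ell_e_unbounded (marked_word m d)"
      unfolding E_def by (rule imageE) blast
    have "ell_e_unbounded (marked_word m e) \<le> Max E" if "e \<in> {m..2 * m}" for e
      using E(1) that by (intro Max_ge) (auto simp: E_def)
    with d show ?thesis by auto
  qed
  then obtain d where d: "\<And>m. d m \<in> {m..2 * m}"
    and max: "\<And>m e. e \<in> {m..2 * m} \<Longrightarrow>
      ell_e_unbounded (marked_word m e) \<le> ell_e_unbounded (marked_word m (d m))"
    by metis
  \<comment> \<open>Powers of two allow the explicit choice \<open>D = k + 2\<close>, as
    \<open>2 * 2 ^ k + 1 \<le> 2 ^ (k + 2)\<close>.\<close>
  define w where "w k = marked_word (2 ^ k) (d (2 ^ k))" for k :: nat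
  have len: "length (w k) = 2 * 2 ^ k + 1" for k
    using d[of "2 ^ k"] by (simp add: w_def length_marked_word)
  have "inj w"
    by (rule injI) (metis len add_right_cancel mult_cancel1 power_inject_exp one_less_numeral_iff
        semiring_norm(76) zero_neq_numeral)
  then have "infinite (range w)" using finite_imageD by blast
  moreover have "\<exists>v\<in>range w. length v \<ge> N" for N
  proof -
    have "N < 2 ^ N" by (rule less_exp)
    then have "N \<le> length (w N)" unfolding len by linarith
    then show ?thesis by blast
  qed
  ultimately have fam: "string_family (range w)"
    by (simp add: string_family_def)
  have "(\<lambda>v. real (ell c v)) \<in> o[family_filter (range w)](\<lambda>v. real (ell_e c v))" if c: "c \<ge> 1" for c
  proof (rule landau_o.smallI)
    fix \<epsilon> :: real assume \<epsilon>: "\<epsilon> > 0"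
    \<comment> \<open>The 9 is the bound on \<open>ell\<close> for the marked words.\<close>
    obtain K :: nat where K: "9 / \<epsilon> < real K" using reals_Archimedean2 by blast
    define C where "C = card (expanding_codes K)"
    \<comment> \<open>\<open>C\<close> depends on \<open>K\<close> alone, so the exponential side
      wins; this is the counting hypothesis with \<open>D = k + 2\<close> and
      \<open>m = 2 ^ k\<close>.\<close>
    have "eventually (\<lambda>k. real C * (real k + 2 + real K) \<le> 2 ^ k) sequentially"
      by real_asymp
    then obtain k0 where k0: "\<And>k. k \<ge> k0 \<Longrightarrow> real C * (real k + 2 + real K) \<le> 2 ^ k"
      by (auto simp: eventually_sequentially)
    show "eventually (\<lambda>v. norm (real (ell c v)) \<le> \<epsilon> * norm (real (ell_e c v)))
        (family_filter (range w))"
      unfolding eventually_family_filter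
    proof (intro exI ballI impI)
      fix v assume "v \<in> range w" and long: "2 * 2 ^ k0 + 1 \<le> length v"
      then obtain k where v: "v = w k" by blast
      with long have "k \<ge> k0" by (simp add: len)
      from k0[OF this] have "real (C * (k + 2 + K)) \<le> real (2 ^ k)"
        by (simp add: algebra_simps)
      then have "C * (k + 2 + K) \<le> 2 ^ k" by (simp only: of_nat_le_iff)
      then obtain e where "e \<in> {2 ^ k..2 * 2 ^ k}" "K < ell_e_unbounded (marked_word (2 ^ k) e)"
        using ex_marked_word_ell_e_large[of K "k + 2" "2 ^ k"] by (auto simp: C_def)
      with max[of e "2 ^ k"] have "K < ell_e_unbounded v"
        by (simp add: v w_def)
      also have "\<dots> \<le> ell_e c v"
        using c by (intro ell_e_unbounded_le) (auto simp: v w_def marked_word_nonempty)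
      finally have "9 / \<epsilon> < real (ell_e c v)" using K by linarith
      then have "9 < \<epsilon> * real (ell_e c v)"
        using \<epsilon> by (simp add: field_simps)
      moreover have "ell c v \<le> 9"
        unfolding v w_def using d[of "2 ^ k"] c by (intro ell_marked_word_le) auto
      ultimately show "norm (real (ell c v)) \<le> \<epsilon> * norm (real (ell_e c v))" by simp
    qed
  qed
  with fam show ?thesis by blast
qed

end
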